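(* Let $\ell$ be a loss whose partial loss $\ell_1$ is strictly decreasing and whose partial loss $\ell_{-1}$ is strictly increasing. Then the corresponding Super Loss, with partial losses $L_{b,\lambda}(\ell,\sigma^*(\ell_b))$, $b\in\{-1,1\}$, is not twist-proper.
   Context: A class probability estimation loss with partial losses $\ell_1,\ell_{-1}$ on $[0,1]$ has pointwise conditional risk $L(u,v)=v\,\ell_1(u)+(1-v)\,\ell_{-1}(u)$ and (set-valued) Bayes tilted estimate $t_\ell(v)=\arg\inf_{u\in[0,1]}L(u,v)$. A twist is a general mapping $\eta_c\mapsto\eta_t$ from a clean posterior $\eta_c\in[0,1]$ to a twisted posterior $\eta_t\in[0,1]$. A loss with hyperparameter(s) is twist-proper iff for any twist there exist hyperparameter(s) such that $\eta_c\in t_\ell(\eta_t)$. Super Loss: given a loss $\ell$ with partial losses $\ell_b$, $b\in\{-1,1\}$, and user-defined parameters $\tau\in\mathrm{Im}\,\ell_b$, $\lambda>0$ (the hyperparameters), its partial losses are $u\mapsto L_{b,\lambda}(\ell,\sigma)=(\ell_b(u)-\tau)\sigma+\lambda(\log\sigma)^2$ evaluated at $\sigma=\sigma^*(\ell_b(u))$, where $$\sigma^*(\ell_b)=\exp\!\left(-W\!\left(\tfrac12\max\left(-\tfrac2e,\beta\right)\right)\right),\qquad\beta=\frac{\ell_b-\tau}{\lambda},$$ and $W$ is Lambert's function (principal branch, $W(z)e^{W(z)}=z$ for $z\ge-1/e$). *)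

theory Defs
  imports Complex_Main "HOL-Library.Extended_Real" "HOL-Library.FuncSet"
begin

text \<open>
  A loss is given by its partial losses \<open>l 1\<close> and \<open>l (-1)\<close>; only the labels \<open>1\<close> and \<open>-1\<close> and
  arguments in \<open>{0..1}\<close> are ever used.  Values are extended reals, so that losses that are infinite
  at an endpoint, such as the log-loss, are covered together with the real-valued ones.
\<close>

type_synonym cpe_loss = "int \<Rightarrow> real \<Rightarrow> ereal"

text \<open>In extended reals \<open>0 * \<infinity> = 0\<close>, the usual convention for the conditional risk.\<close>

definition cond_risk :: "cpe_loss \<Rightarrow> real \<Rightarrow> real \<Rightarrow> ereal" where
  "cond_risk l u v = ereal v * l 1 u + ereal (1 - v) * l (-1) u"

definition bayes_tilted :: "cpe_loss \<Rightarrow> real \<Rightarrow> real set" where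
  "bayes_tilted l v = {u. is_arg_min (\<lambda>u. cond_risk l u v) (\<lambda>u. u \<in> {0..1}) u}"

text \<open>
  \<open>F h\<close> is the loss with hyperparameters \<open>h\<close>, and \<open>H\<close> the set of admissible hyperparameters.
  The hyperparameters may depend on the posterior \<open>\<eta>\<close> being twisted, as well as on the twist \<open>T\<close>.
  This is the weaker of the two possible notions: see \<open>twist_proper_if_uniform\<close>.
\<close>

definition twist_proper :: "'h set \<Rightarrow> ('h \<Rightarrow> cpe_loss) \<Rightarrow> bool" where
  "twist_proper H F \<longleftrightarrow>
     (\<forall>T \<in> {0..1} \<rightarrow> {0..1}. \<forall>\<eta>\<in>{0..1}. \<exists>h\<in>H. \<eta> \<in> bayes_tilted (F h) (T \<eta>))"

lemma twist_proper_if_uniform: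
  assumes "\<forall>T \<in> {0..1} \<rightarrow> {0..1}. \<exists>h\<in>H. \<forall>\<eta>\<in>{0..1}. \<eta> \<in> bayes_tilted (F h) (T \<eta>)"
  shows "twist_proper H F"
  using assms unfolding twist_proper_def by meson

lemma twist_proper_mono:
  assumes "twist_proper H F" "H \<subseteq> H'"
  shows "twist_proper H' F"
  using assms unfolding twist_proper_def by (meson subsetD)

text \<open>Principal branch; unspecified for \<open>z < -1/e\<close>.\<close>

definition lambert_w :: "real \<Rightarrow> real" where
  "lambert_w z = (THE w. w \<ge> -1 \<and> w * exp w = z)"

lemma mult_exp_strict_mono:
  fixes x y :: real
  assumes "-1 \<le> x" "x < y"
  shows "x * exp x < y * exp y"
proof (rule DERIV_pos_imp_increasing_open[OF assms(2)])
  fix w assume "x < w" "w < y"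
  have "((\<lambda>w. w * exp w) has_real_derivative (1 + w) * exp w) (at w)"
    by (auto intro!: derivative_eq_intros simp: algebra_simps)
  moreover have "(1 + w) * exp w > 0"
    using \<open>x < w\<close> assms(1) by simp
  ultimately show "\<exists>d. ((\<lambda>w. w * exp w) has_real_derivative d) (at w) \<and> d > 0"
    by blast
qed (auto intro!: continuous_intros)

lemma lambert_w:
  assumes "z \<ge> - exp (-1)"
  shows "lambert_w z \<ge> -1" "lambert_w z * exp (lambert_w z) = z"
proof -
  define b where "b = max 0 z"
  have "b \<le> b * exp b"
    using mult_left_mono[of 1 "exp b" b] by (auto simp: b_def)
  then have "z \<le> b * exp b"
    by (simp add: b_def)
  then have "\<exists>w\<ge>-1. w \<le> b \<and> w * exp w = z"
    using assms by (intro IVT') (auto simp: b_def intro!: continuous_intros)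
  then have "\<exists>!w. w \<ge> -1 \<and> w * exp w = z"
    by (metis linorder_neqE_linordered_idom mult_exp_strict_mono order_less_irrefl)
  from theI'[OF this] show "lambert_w z \<ge> -1" "lambert_w z * exp (lambert_w z) = z"
    by (simp_all add: lambert_w_def)
qed

text \<open>Here \<open>x\<close> is the value of the original partial loss, and \<open>exp (-1)\<close> is \<open>1/e\<close>.\<close>

definition super_obj :: "real \<Rightarrow> real \<Rightarrow> real \<Rightarrow> real \<Rightarrow> real" where
  "super_obj \<tau> lam x \<sigma> = (x - \<tau>) * \<sigma> + lam * (ln \<sigma>)\<^sup>2"

definition sigma_star :: "real \<Rightarrow> real \<Rightarrow> real \<Rightarrow> real" where
  "sigma_star \<tau> lam x = exp (- lambert_w (1/2 * max (- 2 * exp (-1)) ((x - \<tau>) / lam)))"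

text \<open>
  At infinite values the super loss is the limit of its values at reals.
\<close>

definition super_value :: "real \<Rightarrow> real \<Rightarrow> ereal \<Rightarrow> ereal" where
  "super_value \<tau> lam y =
     (case y of ereal x \<Rightarrow> ereal (super_obj \<tau> lam x (sigma_star \<tau> lam x))
      | PInfty \<Rightarrow> \<infinity>
      | MInfty \<Rightarrow> -\<infinity>)"

definition super_loss :: "cpe_loss \<Rightarrow> real \<times> real \<Rightarrow> cpe_loss" where
  "super_loss l = (\<lambda>(\<tau>, lam) b u. super_value \<tau> lam (l b u))"

text \<open>
  The threshold may come from the image of either partial loss.  Requiring it to be in both
  images gives a subset: see \<open>twist_proper_mono\<close>.
\<close>

definition super_params :: "cpe_loss \<Rightarrow> (real \<times> real) set" where
  "super_params l = {(\<tau>, lam). lam > 0 \<and> (\<exists>b\<in>{-1, 1}. ereal \<tau> \<in> l b ` {0..1})}"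

end

theory Submission
  imports Defs
begin

text \<open>
  The super value, as a function of the original value, is strictly increasing, so the super loss
  keeps the partial loss for the label \<open>1\<close> strictly decreasing. At the twisted posterior \<open>1\<close> the
  conditional risk is that partial loss, and the clean posterior \<open>0\<close> is not one of its minimisers.
\<close>

text \<open>\<open>lambert_w\<close> inverts \<open>w * exp w\<close>, which is strictly increasing
  from \<open>-1\<close> on.\<close>

lemma lambert_w_strict_mono:
  assumes "- exp (-1) \<le> y" "y < z"
  shows "lambert_w y < lambert_w z"
proof (rule ccontr)
  assume "\<not> lambert_w y < lambert_w z"
  then have "lambert_w z * exp (lambert_w z) \<le> lambert_w y * exp (lambert_w y)"
    using mult_exp_strict_mono[of "lambert_w z" "lambert_w y"] lambert_w(1)[of z] assms
    by (cases "lambert_w z = lambert_w y") auto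
  then show False
    using lambert_w(2)[of y] lambert_w(2)[of z] assms by simp
qed

lemma lambert_w_minus_exp: "lambert_w (- exp (-1)) = -1"
proof (rule ccontr)
  assume "lambert_w (- exp (-1)) \<noteq> -1"
  then show False
    using lambert_w[of "- exp (-1)"] mult_exp_strict_mono[of "-1" "lambert_w (- exp (-1))"]
    by simp
qed

text \<open>The maximum in \<open>sigma_star\<close> is attained by its constant, so Lambert's
  function is \<open>-1\<close> and \<open>sigma_star\<close> is stuck at \<open>exp 1\<close>: an
  affine regime of slope \<open>exp 1\<close>.\<close>

lemma super_obj_sigma_star_le:
  assumes "lam > 0" "(x - \<tau>) / lam \<le> - 2 * exp (-1)"
  shows "super_obj \<tau> lam x (sigma_star \<tau> lam x) = (x - \<tau>) * exp 1 + lam"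
  using assms lambert_w_minus_exp
  by (simp add: super_obj_def sigma_star_def max_absorb1)

text \<open>For the Lambert value \<open>w\<close>, the linear term becomes
  \<open>2 * lam * w\<close> and the squared logarithm \<open>w\<^sup>2\<close>. Completing the
  square makes monotonicity in \<open>w \<ge> -1\<close> visible.\<close>

lemma super_obj_sigma_star_ge:
  assumes "lam > 0" "(x - \<tau>) / lam \<ge> - 2 * exp (-1)"
  shows "super_obj \<tau> lam x (sigma_star \<tau> lam x) =
    lam * ((lambert_w ((x - \<tau>) / lam / 2) + 1)\<^sup>2 - 1)"
proof -
  define w where "w = lambert_w ((x - \<tau>) / lam / 2)"
  have "w * exp w = (x - \<tau>) / lam / 2"
    unfolding w_def using assms by (intro lambert_w(2)) simp
  then have "x - \<tau> = 2 * lam * w * exp w"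
    using assms(1) by (simp add: field_simps)
  then have "(x - \<tau>) * exp (- w) = 2 * lam * w"
    by (simp add: exp_minus)
  moreover have "sigma_star \<tau> lam x = exp (- w)"
    using assms(2) by (simp add: sigma_star_def w_def max_absorb2 mult.commute)
  ultimately show ?thesis
    unfolding w_def[symmetric] by (simp add: super_obj_def power2_eq_square algebra_simps)
qed

lemma super_obj_sigma_star_strict_mono:
  assumes "lam > 0" "x < y"
  shows "super_obj \<tau> lam x (sigma_star \<tau> lam x) < super_obj \<tau> lam y (sigma_star \<tau> lam y)"
    (is "?G x < ?G y")
proof -
  \<comment> \<open>The value at which the two regimes meet; both closed forms hold there.\<close>
  define c where "c = \<tau> - 2 * exp (-1) * lam"
  have le: "(z - \<tau>) / lam \<le> - 2 * exp (-1) \<longleftrightarrow> z \<le> c"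
    and ge: "(z - \<tau>) / lam \<ge> - 2 * exp (-1) \<longleftrightarrow> z \<ge> c" for z
    using assms(1) by (auto simp: c_def field_simps)
  have below: "?G u < ?G v" if "u < v" "v \<le> c" for u v
    using that assms(1) super_obj_sigma_star_le[of lam _ \<tau>, unfolded le]
    by simp
  have above: "?G u < ?G v" if "u < v" "c \<le> u" for u v
  proof -
    have u: "- exp (-1) \<le> (u - \<tau>) / lam / 2"
      using that ge[of u] by simp
    moreover have "(u - \<tau>) / lam / 2 < (v - \<tau>) / lam / 2"
      using that assms(1) by (simp add: divide_strict_right_mono)
    ultimately have "lambert_w ((u - \<tau>) / lam / 2) < lambert_w ((v - \<tau>) / lam / 2)"
      by (rule lambert_w_strict_mono)
    with lambert_w(1)[OF u] have "(lambert_w ((u - \<tau>) / lam / 2) + 1)\<^sup>2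
        < (lambert_w ((v - \<tau>) / lam / 2) + 1)\<^sup>2"
      by (intro power_strict_mono) auto
    then show ?thesis
      using that assms(1) super_obj_sigma_star_ge[of lam _ \<tau>, unfolded ge]
      by simp
  qed
  \<comment> \<open>If \<open>c\<close> lies strictly between \<open>x\<close> and \<open>y\<close>,
    the two inequalities chain through \<open>c\<close>.\<close>
  show ?thesis
    using below[of x y] above[of x y] below[of x c] above[of c y] assms(2)
    by linarith
qed

lemma super_value_strict_mono:
  assumes "lam > 0" "y < z"
  shows "super_value \<tau> lam y < super_value \<tau> lam z"
  using assms super_obj_sigma_star_strict_mono[of lam]
  by (cases y; cases z) (auto simp: super_value_def)

theorem lemma13:
  fixes l :: cpe_loss
  assumes "strict_antimono_on {0..1} (l 1)"
    and "strict_mono_on {0..1} (l (-1))"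
  shows "\<not> twist_proper (super_params l) (super_loss l)"
proof
  assume "twist_proper (super_params l) (super_loss l)"
  \<comment> \<open>The twist is constantly \<open>1\<close>, tested at the clean posterior
    \<open>0\<close>.\<close>
  then have "\<exists>h\<in>super_params l. 0 \<in> bayes_tilted (super_loss l h) ((\<lambda>_. 1) (0::real))"
    unfolding twist_proper_def by (elim ballE) auto
  then obtain \<tau> lam where "(\<tau>, lam) \<in> super_params l"
    and 0: "0 \<in> bayes_tilted (super_loss l (\<tau>, lam)) 1"
    by auto
  then have "lam > 0"
    by (simp add: super_params_def)
  moreover have "l 1 1 < l 1 0"
    using monotone_onD[OF assms(1), of 0 1] by simp
  ultimately have "super_value \<tau> lam (l 1 1) < super_value \<tau> lam (l 1 0)"
    by (rule super_value_strict_mono)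
  \<comment> \<open>The other label has weight \<open>0\<close>, which annihilates even an infinite
    loss in \<open>ereal\<close>.\<close>
  moreover have "cond_risk (super_loss l (\<tau>, lam)) u 1 = super_value \<tau> lam (l 1 u)" for u
    by (simp add: cond_risk_def super_loss_def flip: one_ereal_def zero_ereal_def)
  ultimately show False
    \<comment> \<open>The point \<open>1\<close> has smaller risk than \<open>0\<close>.\<close>
    using 0 by (auto simp: bayes_tilted_def is_arg_min_def dest: spec[of _ 1])
qed

end
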